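(* Fix $\theta\in\{0,1\}$ and a limiter function $\psi:\mathbb{R}\to\mathbb{R}$. Suppose that the forward Euler flux-form scheme described in the context is positivity preserving for incompressible flow (as defined in the context). Then: - if $\theta=1$: $\psi(R)\ge 0$ for all $R\in(-\infty,0]$, and $\psi(S)/S\le 2$ for all $S\in(0,\infty)$; - if $\theta=0$: $\psi(T)\le 2$ for all $T\in(0,\infty)$, and $\psi(S)/S\ge 0$ for all $S\in(-\infty,0)$.
   Context: Cells are indexed by $(i,j)\in\mathbb{Z}^2$, and $u=(u_{i,j})$ is a real-valued grid function. Face velocities are real numbers $c_{i+1/2,j}$ ($x$-component at the face between cells $(i,j)$ and $(i+1,j)$) and $c_{i,j+1/2}$ ($y$-component at the face between cells $(i,j)$ and $(i,j+1)$); the time step and mesh spacing have been absorbed into $c$. Write $a^+=\max(a,0)$, $a^-=\min(a,0)$. Reconstruction. With $R_i=\frac{u_{i+1,j}-u_{i,j}}{u_{i,j}-u_{i-1,j}}$ and $R_j=\frac{u_{i,j+1}-u_{i,j}}{u_{i,j}-u_{i,j-1}}$, the right, left, up and down values of cell $(i,j)$ are $$u^R_{i,j}=u_{i,j}+\tfrac{\theta}{2}\psi(R_i)(u_{i,j}-u_{i-1,j})+\tfrac{1-\theta}{2}\psi(1/R_i)(u_{i+1,j}-u_{i,j}),$$ $$u^L_{i,j}=u_{i,j}+\tfrac{\theta}{2}\psi(1/R_i)(u_{i,j}-u_{i+1,j})-\tfrac{1-\theta}{2}\psi(R_i)(u_{i,j}-u_{i-1,j}),$$ $$u^U_{i,j}=u_{i,j}+\tfrac{\theta}{2}\psi(R_j)(u_{i,j}-u_{i,j-1})+\tfrac{1-\theta}{2}\psi(1/R_j)(u_{i,j+1}-u_{i,j}),$$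 $$u^D_{i,j}=u_{i,j}+\tfrac{\theta}{2}\psi(1/R_j)(u_{i,j}-u_{i,j+1})-\tfrac{1-\theta}{2}\psi(R_j)(u_{i,j}-u_{i,j-1}).$$ Here $1/R_i$ denotes the reciprocal ratio $\frac{u_{i,j}-u_{i-1,j}}{u_{i+1,j}-u_{i,j}}$ (similarly $1/R_j$). Convention for vanishing denominators: every limiter term above has the form $\pm\psi(p/q)\,q$, with $p,q$ successive differences of $u$, and is interpreted as $0$ when $q=0$. Donor cell fluxes: $$F_{i+1/2,j}=c^+_{i+1/2,j}u^R_{i,j}+c^-_{i+1/2,j}u^L_{i+1,j},\qquad F_{i,j+1/2}=c^+_{i,j+1/2}u^U_{i,j}+c^-_{i,j+1/2}u^D_{i,j+1}.$$ Forward Euler scheme (all reconstructions computed from $u=u^n$): $$u^{n+1}_{i,j}=u^n_{i,j}-\bigl[F_{i+1/2,j}-F_{i-1/2,j}\bigr]-\bigl[F_{i,j+1/2}-F_{i,j-1/2}\bigr].$$ A velocity field $c$ is discretely divergence free if $c_{i+1/2,j}-c_{i-1/2,j}+c_{i,j+1/2}-c_{i,j-1/2}=0$ for all $(i,j)$. Its Courant number at cell $(i,j)$ is $c_{i+1/2,j}^{+}-c_{i-1/2,j}^{-}+c_{i,j+1/2}^{+}-c_{i,j-1/2}^{-}$. The scheme is called positivity preserving for incompressible flow if there is some $C_0>0$ such that, for every discretely divergence free $c$ whose Courant number is at most $C_0$ at every cell and every grid function $u^n$ with $u^n_{i,j}\ge0$ for all $(i,j)$, one has $u^{n+1}_{i,j}\ge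 0$ for all $(i,j)$. *)

theory Defs
  imports Complex_Main
begin

text \<open>A grid function, indexed by the cells \<open>(i, j)\<close>.  A velocity field is given by two such
  functions, \<open>cx\<close> and \<open>cy\<close>, with the half-integer index shifted down: \<open>cx i j\<close> is the velocity
  at the face between cells \<open>(i, j)\<close> and \<open>(i + 1, j)\<close>, and \<open>cy i j\<close> is the velocity at the face
  between \<open>(i, j)\<close> and \<open>(i, j + 1)\<close>.  Fluxes are indexed in the same way.\<close>

type_synonym grid = "int \<Rightarrow> int \<Rightarrow> real"

definition pos :: "real \<Rightarrow> real" where
  "pos a = max a 0"

definition neg :: "real \<Rightarrow> real" where
  "neg a = min a 0"  \<comment> \<open>the nonpositive part, so that \<open>a = pos a + neg a\<close>\<close>

text \<open>The limiter term \<open>\<psi>(p / q) q\<close>, which is \<open>0\<close> by convention when \<open>q = 0\<close>.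
  With \<open>p\<close> and \<open>q\<close> the forward and backward difference at a cell, \<open>R = p / q\<close>, so that
  \<open>lim_term \<psi> p q\<close> is \<open>\<psi>(R) q\<close> and \<open>lim_term \<psi> q p\<close> is \<open>\<psi>(1 / R) p\<close>.  The terms
  \<open>\<psi>(1 / R) (u\<^sub>i - u\<^sub>i\<^sub>+\<^sub>1)\<close> in the left and down values are \<open>- lim_term \<psi> q p\<close>.\<close>

definition lim_term :: "(real \<Rightarrow> real) \<Rightarrow> real \<Rightarrow> real \<Rightarrow> real" where
  "lim_term \<psi> p q = (if q = 0 then 0 else \<psi> (p / q) * q)"

definition right_val :: "real \<Rightarrow> (real \<Rightarrow> real) \<Rightarrow> grid \<Rightarrow> grid" where
  "right_val \<theta> \<psi> u i j = u i j
     + \<theta> / 2 * lim_term \<psi> (u (i + 1) j - u i j) (u i j - u (i - 1) j)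
     + (1 - \<theta>) / 2 * lim_term \<psi> (u i j - u (i - 1) j) (u (i + 1) j - u i j)"

definition left_val :: "real \<Rightarrow> (real \<Rightarrow> real) \<Rightarrow> grid \<Rightarrow> grid" where
  "left_val \<theta> \<psi> u i j = u i j
     - \<theta> / 2 * lim_term \<psi> (u i j - u (i - 1) j) (u (i + 1) j - u i j)
     - (1 - \<theta>) / 2 * lim_term \<psi> (u (i + 1) j - u i j) (u i j - u (i - 1) j)"

definition up_val :: "real \<Rightarrow> (real \<Rightarrow> real) \<Rightarrow> grid \<Rightarrow> grid" where
  "up_val \<theta> \<psi> u i j = u i j
     + \<theta> / 2 * lim_term \<psi> (u i (j + 1) - u i j) (u i j - u i (j - 1))
     + (1 - \<theta>) / 2 * lim_term \<psi> (u i j - u i (j - 1)) (u i (j + 1) - u i j)"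

definition down_val :: "real \<Rightarrow> (real \<Rightarrow> real) \<Rightarrow> grid \<Rightarrow> grid" where
  "down_val \<theta> \<psi> u i j = u i j
     - \<theta> / 2 * lim_term \<psi> (u i j - u i (j - 1)) (u i (j + 1) - u i j)
     - (1 - \<theta>) / 2 * lim_term \<psi> (u i (j + 1) - u i j) (u i j - u i (j - 1))"

definition flux_x :: "real \<Rightarrow> (real \<Rightarrow> real) \<Rightarrow> grid \<Rightarrow> grid \<Rightarrow> grid" where
  "flux_x \<theta> \<psi> cx u i j =
     pos (cx i j) * right_val \<theta> \<psi> u i j + neg (cx i j) * left_val \<theta> \<psi> u (i + 1) j"

definition flux_y :: "real \<Rightarrow> (real \<Rightarrow> real) \<Rightarrow> grid \<Rightarrow> grid \<Rightarrow> grid" where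
  "flux_y \<theta> \<psi> cy u i j =
     pos (cy i j) * up_val \<theta> \<psi> u i j + neg (cy i j) * down_val \<theta> \<psi> u i (j + 1)"

definition forward_euler ::
  "real \<Rightarrow> (real \<Rightarrow> real) \<Rightarrow> grid \<Rightarrow> grid \<Rightarrow> grid \<Rightarrow> grid" where
  "forward_euler \<theta> \<psi> cx cy u i j = u i j
     - (flux_x \<theta> \<psi> cx u i j - flux_x \<theta> \<psi> cx u (i - 1) j)
     - (flux_y \<theta> \<psi> cy u i j - flux_y \<theta> \<psi> cy u i (j - 1))"

definition div_free :: "grid \<Rightarrow> grid \<Rightarrow> bool" where
  "div_free cx cy \<longleftrightarrow> (\<forall>i j. cx i j - cx (i - 1) j + cy i j - cy i (j - 1) = 0)"

definition courant :: "grid \<Rightarrow> grid \<Rightarrow> grid" where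
  "courant cx cy i j =
     pos (cx i j) - neg (cx (i - 1) j) + pos (cy i j) - neg (cy i (j - 1))"

definition positivity_preserving :: "real \<Rightarrow> (real \<Rightarrow> real) \<Rightarrow> bool" where
  "positivity_preserving \<theta> \<psi> \<longleftrightarrow>
     (\<exists>C0>0. \<forall>cx cy u.
        div_free cx cy \<and> (\<forall>i j. courant cx cy i j \<le> C0) \<and> (\<forall>i j. u i j \<ge> 0)
        \<longrightarrow> (\<forall>i j. forward_euler \<theta> \<psi> cx cy u i j \<ge> 0))"

end

theory Submission
  imports Defs
begin

text \<open>A thin stream of strength \<open>s\<close> bends at the cell \<open>(0, 0)\<close>, joining its lower face to its
  right face.  If \<open>u\<close> depends on \<open>i\<close> only and vanishes in the column \<open>i = 0\<close>, nothing is carried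
  through the lower face, so the updated value at \<open>(0, 0)\<close> is minus the flux through the right
  face.  An outgoing stream (\<open>s > 0\<close>) thus forces the right value of the cell \<open>(0, 0)\<close> to be
  nonpositive, and an incoming one (\<open>s < 0\<close>) forces the left value of the cell \<open>(1, 0)\<close> to be
  nonnegative.  Each of the four bounds is one of these two conditions for suitable data.\<close>

definition corner_x :: "real \<Rightarrow> grid" where
  "corner_x s i j = (if j = 0 \<and> 0 \<le> i then s else 0)"

definition corner_y :: "real \<Rightarrow> grid" where
  "corner_y s i j = (if i = 0 \<and> j < 0 then s else 0)"

lemma div_free_corner: "div_free (corner_x s) (corner_y s)"
  by (auto simp: div_free_def corner_x_def corner_y_def)

lemma courant_corner_le: "courant (corner_x s) (corner_y s) i j \<le> \<bar>s\<bar>"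
  by (auto simp: courant_def corner_x_def corner_y_def pos_def neg_def)

text \<open>Differences in \<open>j\<close> vanish, so the convention for \<open>q = 0\<close>
  reduces the up and down values in column 0 to \<open>w 0 = 0\<close>, whatever
  \<open>\<psi>\<close> is.\<close>

lemma forward_euler_corner:
  assumes "w 0 = 0"
  shows "forward_euler \<theta> \<psi> (corner_x s) (corner_y s) (\<lambda>i j. w i) 0 0 =
    - (pos s * right_val \<theta> \<psi> (\<lambda>i j. w i) 0 0 + neg s * left_val \<theta> \<psi> (\<lambda>i j. w i) 1 0)"
  using assms
  by (simp add: forward_euler_def flux_x_def flux_y_def corner_x_def corner_y_def
      up_val_def down_val_def lim_term_def pos_def neg_def)

lemma positivity_preserving_vanishing_column:
  assumes pp: "positivity_preserving \<theta> \<psi>" and w: "\<And>i. w i \<ge> 0" "w 0 = 0"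
  shows right_val_nonpos: "right_val \<theta> \<psi> (\<lambda>i j. w i) 0 0 \<le> 0"
    and left_val_nonneg: "left_val \<theta> \<psi> (\<lambda>i j. w i) 1 0 \<ge> 0"
proof -
  obtain C where C: "C > 0" and
    nonneg: "\<And>cx cy u. div_free cx cy \<Longrightarrow> (\<And>i j. courant cx cy i j \<le> C) \<Longrightarrow>
      (\<And>i j. u i j \<ge> 0) \<Longrightarrow> forward_euler \<theta> \<psi> cx cy u 0 0 \<ge> 0"
    using pp unfolding positivity_preserving_def by meson
  have flux: "pos s * right_val \<theta> \<psi> (\<lambda>i j. w i) 0 0 + neg s * left_val \<theta> \<psi> (\<lambda>i j. w i) 1 0 \<le> 0"
    if "\<bar>s\<bar> \<le> C" for s
  proof -
    have "forward_euler \<theta> \<psi> (corner_x s) (corner_y s) (\<lambda>i j. w i) 0 0 \<ge> 0"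
      using that by (intro nonneg div_free_corner w order_trans[OF courant_corner_le])
    then show ?thesis
      using forward_euler_corner[of w, OF w(2)] by simp
  qed
  show "right_val \<theta> \<psi> (\<lambda>i j. w i) 0 0 \<le> 0"
    \<comment> \<open>Only the sign of \<open>s\<close> matters; \<open>C\<close> and
      \<open>- C\<close> respect the Courant bound.\<close>
    using flux[of C] C by (simp add: pos_def neg_def mult_le_0_iff)
  show "left_val \<theta> \<psi> (\<lambda>i j. w i) 1 0 \<ge> 0"
    using flux[of "- C"] C by (simp add: pos_def neg_def zero_le_mult_iff)
qed

lemma right_limiter_nonpos:
  assumes "positivity_preserving \<theta> \<psi>" and "a \<ge> 0" "b \<ge> 0"
  shows "\<theta> * lim_term \<psi> b (- a) + (1 - \<theta>) * lim_term \<psi> (- a) b \<le> 0"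
proof -
  \<comment> \<open>A minimum at 0: the two differences there, \<open>- a\<close> and
    \<open>b\<close>, have a ratio of nonpositive sign.\<close>
  define w :: "int \<Rightarrow> real" where "w = (\<lambda>_. 0)(- 1 := a, 1 := b)"
  have "w i \<ge> 0" for i
    using assms(2,3) by (simp add: w_def)
  then show ?thesis
    using right_val_nonpos[OF assms(1), of w] by (simp add: w_def right_val_def)
qed

lemma left_limiter_le:
  assumes "positivity_preserving \<theta> \<psi>" and "p \<ge> 0" "q \<ge> 0"
  shows "\<theta> * lim_term \<psi> q p + (1 - \<theta>) * lim_term \<psi> p q \<le> 2 * q"
proof -
  \<comment> \<open>Increasing data: the differences at cell 1 are \<open>q\<close> and
    \<open>p\<close>, and \<open>w 1 = q\<close> yields the bound \<open>2 * q\<close>.\<close>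
  define w :: "int \<Rightarrow> real" where "w = (\<lambda>_. 0)(1 := q, 2 := q + p)"
  have "w i \<ge> 0" for i
    using assms(2,3) by (simp add: w_def)
  then show ?thesis
    using left_val_nonneg[OF assms(1), of w] by (simp add: w_def left_val_def)
qed

theorem theorem3p2:
  fixes \<theta> :: real and \<psi> :: "real \<Rightarrow> real"
  assumes "\<theta> \<in> {0, 1}"
    and "positivity_preserving \<theta> \<psi>"
  shows "(\<theta> = 1 \<longrightarrow> (\<forall>R\<in>{..0}. \<psi> R \<ge> 0) \<and> (\<forall>S\<in>{0<..}. \<psi> S / S \<le> 2)) \<and>
         (\<theta> = 0 \<longrightarrow> (\<forall>T\<in>{0<..}. \<psi> T \<le> 2) \<and> (\<forall>S\<in>{..<0}. \<psi> S / S \<ge> 0))"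
proof (intro conjI impI ballI)
  note right = right_limiter_nonpos[OF assms(2)] and left = left_limiter_le[OF assms(2)]
  \<comment> \<open>In all four cases the surviving limiter term has denominator 1 or -1, so the
    ratio is the given argument; this covers \<open>R = 0\<close> too.\<close>
  show "\<psi> R \<ge> 0" if "\<theta> = 1" "R \<in> {..0}" for R
    using right[of 1 "- R"] that by (simp add: lim_term_def)
  show "\<psi> S / S \<le> 2" if "\<theta> = 1" "S \<in> {0<..}" for S
    using left[of 1 S] that by (simp add: lim_term_def divide_le_eq)
  show "\<psi> T \<le> 2" if "\<theta> = 0" "T \<in> {0<..}" for T
    using left[of T 1] that by (simp add: lim_term_def)
  show "\<psi> S / S \<ge> 0" if "\<theta> = 0" "S \<in> {..<0}" for S
    using right[of "- S" 1] that by (simp add: lim_term_def zero_le_divide_iff)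
qed

end
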